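(* Let $G$ and $H$ be graphs of coprime orders $N_1$ and $N_2$, each with at least one edge. Then $$\operatorname{FR}_{\min}(G\times H)\leq\operatorname{FR}_{\min}(G)\operatorname{FR}_{\min}(H),$$ where $G\times H$ denotes the weak product.
   Context: Graphs are finite, simple and undirected. The weak product $G\times H$ has vertex set $V(G)\times V(H)$, and $(g_1,h_1)$ is adjacent to $(g_2,h_2)$ if and only if $g_1$ is adjacent to $g_2$ in $G$ and $h_1$ is adjacent to $h_2$ in $H$. A vertex labeling of a graph $G=(V,E)$ of order $N=|V|$ is a bijection $\sigma:V\to\mathbb Z_N=\mathbb Z/N\mathbb Z$. The adjacency matrix under $\sigma$ is the $N\times N$ matrix $A_\sigma$, indexed by $\mathbb Z_N\times\mathbb Z_N$, with $(A_\sigma)_{x,y}=1$ if the vertices labeled $x$ and $y$ are adjacent and $0$ otherwise. $F$ is the unitary Fourier matrix $F_{mx}=\frac1{\sqrt N}e^{-2\pi i mx/N}$. The Fourier ratio of a nonzero $N\times N$ matrix $M$ is $\operatorname{FR}(M)=\|FMF\|_1/\|FMF\|_2$, where $\|\cdot\|_1$ is the entrywise $\ell^1$-norm and $\|\cdot\|_2$ the Frobenius norm. The edge complexity of a graph with at least one edge is $\operatorname{FR}_{\min}(G)=\min_\sigma\operatorname{FR}(A_\sigma)$, the minimum over all vertex labelings (by $\mathbb Z_N$ with $N$ the order of that graph). *)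

theory Defs
  imports Complex_Main "HOL-Library.FuncSet" "Jordan_Normal_Form.Matrix"
    "Graph_Theory.Pair_Digraph"
begin

text \<open>Finite simple undirected graphs are the \<open>pair_graph\<close>s of \<open>Graph_Theory\<close>:
  \<open>parcs\<close> is a symmetric irreflexive relation on the finite set \<open>pverts\<close>,
  so an edge is represented by both of its orientations.\<close>

abbreviation graph_order :: "'a pair_pre_digraph \<Rightarrow> nat" where
  "graph_order G \<equiv> card (pverts G)"

definition weak_product ::
  "'a pair_pre_digraph \<Rightarrow> 'b pair_pre_digraph \<Rightarrow> ('a \<times> 'b) pair_pre_digraph" where
  "weak_product G H =
     \<lparr> pverts = pverts G \<times> pverts H,
       parcs = {((g1, h1), (g2, h2)) | g1 h1 g2 h2.
                  (g1, g2) \<in> parcs G \<and> (h1, h2) \<in> parcs H} \<rparr>"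

text \<open>The group of integers modulo \<open>N\<close> is represented by its residues \<open>{..<N}\<close>, which are
  also the matrix indices. Labelings are extensional, so there are only finitely many.\<close>

definition labelings :: "'a pair_pre_digraph \<Rightarrow> ('a \<Rightarrow> nat) set" where
  "labelings G = {\<sigma> \<in> extensional (pverts G). bij_betw \<sigma> (pverts G) {..<graph_order G}}"

definition adjacency_matrix :: "'a pair_pre_digraph \<Rightarrow> ('a \<Rightarrow> nat) \<Rightarrow> complex mat" where
  "adjacency_matrix G \<sigma> = mat (graph_order G) (graph_order G)
     (\<lambda>(x, y). if (inv_into (pverts G) \<sigma> x, inv_into (pverts G) \<sigma> y) \<in> parcs G
               then 1 else 0)"

definition fourier_matrix :: "nat \<Rightarrow> complex mat" where
  "fourier_matrix N = mat N N
     (\<lambda>(m, x). complex_of_real (1 / sqrt (real N)) *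
               exp (- 2 * complex_of_real pi * \<i> * of_nat m * of_nat x / of_nat N))"

definition entrywise_l1_norm :: "complex mat \<Rightarrow> real" where
  "entrywise_l1_norm M = (\<Sum>i<dim_row M. \<Sum>j<dim_col M. cmod (M $$ (i, j)))"

definition frobenius_norm :: "complex mat \<Rightarrow> real" where
  "frobenius_norm M = sqrt (\<Sum>i<dim_row M. \<Sum>j<dim_col M. (cmod (M $$ (i, j)))\<^sup>2)"

text \<open>Meaningful for nonzero square \<open>M\<close> only.\<close>

definition fourier_ratio :: "complex mat \<Rightarrow> real" where
  "fourier_ratio M =
     (let F = fourier_matrix (dim_row M)
      in entrywise_l1_norm (F * M * F) / frobenius_norm (F * M * F))"

definition edge_complexity :: "'a pair_pre_digraph \<Rightarrow> real" where
  "edge_complexity G = Min ((\<lambda>\<sigma>. fourier_ratio (adjacency_matrix G \<sigma>)) ` labelings G)"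

lemma pair_graph_weak_product:
  assumes "pair_graph G" and "pair_graph H"
  shows "pair_graph (weak_product G H)"
proof -
  interpret G: pair_graph G by fact
  interpret H: pair_graph H by fact
  have sG: "(v, u) \<in> parcs G" if "(u, v) \<in> parcs G" for u v
    using G.pair_sym_arcs that by (auto simp: symmetric_def dest: symD)
  have sH: "(v, u) \<in> parcs H" if "(u, v) \<in> parcs H" for u v
    using H.pair_sym_arcs that by (auto simp: symmetric_def dest: symD)
  have sub: "parcs (weak_product G H) \<subseteq>
      pverts (weak_product G H) \<times> pverts (weak_product G H)"
    by (auto simp: weak_product_def dest: G.in_arcsD1 G.in_arcsD2 H.in_arcsD1 H.in_arcsD2)
  have fin: "finite (pverts (weak_product G H))"
    by (simp add: weak_product_def G.pair_finite_verts H.pair_finite_verts)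
  have sym: "symmetric (with_proj (weak_product G H))"
    unfolding symmetric_def by (auto simp: weak_product_def intro!: symI sG sH)
  show ?thesis
  proof
    show "finite (parcs (weak_product G H))"
      using finite_subset[OF sub] fin by blast
    show "fst e \<noteq> snd e" if "e \<in> parcs (weak_product G H)" for e
      using that G.pair_no_loops by (force simp: weak_product_def)
  qed (use sub fin sym in auto)
qed

lemma finite_labelings: "finite (labelings G)"
proof (cases "finite (pverts G)")
  case True
  have "labelings G \<subseteq> pverts G \<rightarrow>\<^sub>E {..<graph_order G}"
    by (auto simp: labelings_def PiE_def bij_betw_def)
  then show ?thesis
    using True by (meson finite_PiE finite_lessThan finite_subset)
next
  case False
  then have "labelings G = {}"
    using bij_betw_finite by (fastforce simp: labelings_def)
  then show ?thesis by simp
qed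

lemma labelings_nonempty:
  assumes "finite (pverts G)"
  shows "labelings G \<noteq> {}"
proof -
  obtain f where "bij_betw f (pverts G) {..<graph_order G}"
    using assms by (metis bij_betw_iff_card card_lessThan finite_lessThan)
  then have "restrict f (pverts G) \<in> labelings G"
    by (simp add: labelings_def cong: bij_betw_cong)
  then show ?thesis by blast
qed

end

theory Submission
  imports Defs "HOL-Number_Theory.Cong"
begin

text \<open>Label \<open>(g, h)\<close> by \<open>N\<^sub>2 \<sigma>(g) + N\<^sub>1 \<tau>(h)\<close> modulo \<open>N\<^sub>1 N\<^sub>2\<close>. Then the character of frequency
  \<open>m\<close> at this label splits into the characters of frequencies \<open>m\<close> modulo \<open>N\<^sub>1\<close> and \<open>m\<close> modulo
  \<open>N\<^sub>2\<close> at \<open>\<sigma>(g)\<close> and \<open>\<tau>(h)\<close>, and by the Chinese remainder theorem the Fourier transform of the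
  adjacency matrix of the product is, up to a permutation of frequencies, the tensor product of
  the two transforms. Both norms, hence also the Fourier ratio, are multiplicative for tensor
  products; applying this to minimizing labelings gives the bound.\<close>

section \<open>Additive characters modulo N\<close>

definition fourier_char :: "nat \<Rightarrow> nat \<Rightarrow> complex" where
  "fourier_char N t = exp (- 2 * complex_of_real pi * \<i> * of_nat t / of_nat N)"

lemma fourier_char_add: "fourier_char N (s + t) = fourier_char N s * fourier_char N t"
  by (simp add: fourier_char_def exp_add [symmetric] ring_distribs add_divide_distrib diff_divide_distrib)

lemma fourier_char_mult_self:
  assumes "N > 0"
  shows "fourier_char N (N * t) = 1"
proof -
  have "fourier_char N (N * t) = exp (of_nat t * (- 2 * complex_of_real pi * \<i>))"
    using assms by (simp add: fourier_char_def field_simps)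
  also have "\<dots> = exp (- 2 * complex_of_real pi * \<i>) ^ t"
    by (rule exp_of_nat_mult)
  also have "exp (- 2 * complex_of_real pi * \<i>) = 1"
    by (simp add: exp_minus)
  finally show ?thesis by simp
qed

text \<open>Periodicity allows products of frequencies and labels to stay unreduced natural
  numbers.\<close>

lemma fourier_char_mod:
  assumes "N > 0"
  shows "fourier_char N (t mod N) = fourier_char N t"
proof -
  have "fourier_char N t = fourier_char N (N * (t div N) + t mod N)"
    by simp
  also have "\<dots> = fourier_char N (t mod N)"
    using assms by (simp only: fourier_char_add fourier_char_mult_self mult_1)
  finally show ?thesis ..
qed

lemma fourier_char_cancel:
  assumes "M > 0"
  shows "fourier_char (M * N) (M * t) = fourier_char N t"
  using assms by (simp add: fourier_char_def field_simps)

text \<open>Each coefficient of the label cancels one factor of the modulus: \<open>N\<close> leaves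
  a character modulo \<open>M\<close> at \<open>a\<close>, and \<open>M\<close> leaves one modulo
  \<open>N\<close> at \<open>b\<close>. This explains the crosswise coefficients.\<close>

lemma fourier_char_combine:
  assumes "M > 0" "N > 0"
  shows "fourier_char (M * N) (m * ((N * a + M * b) mod (M * N))) =
           fourier_char M (m mod M * a) * fourier_char N (m mod N * b)"
proof -
  have "fourier_char (M * N) (m * ((N * a + M * b) mod (M * N))) =
          fourier_char (M * N) (m * (N * a + M * b))"
    using assms by (metis fourier_char_mod mod_mult_right_eq mult_pos_pos)
  \<comment> \<open>The modulus is commuted in the first factor so that
    \<open>fourier_char_cancel\<close> matches both.\<close>
  also have "\<dots> = fourier_char (N * M) (N * (m * a)) * fourier_char (M * N) (M * (m * b))"
    by (simp add: fourier_char_add [symmetric] algebra_simps)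
  also have "\<dots> = fourier_char M (m * a) * fourier_char N (m * b)"
    using assms by (simp only: fourier_char_cancel)
  also have "\<dots> = fourier_char M (m mod M * a) * fourier_char N (m mod N * b)"
    using assms by (metis fourier_char_mod mod_mult_left_eq)
  finally show ?thesis .
qed

section \<open>The Fourier transform of an adjacency matrix\<close>

text \<open>The entry of \<open>F * A * F\<close> at \<open>(m, k)\<close>, written without inverse
  labelings as a sum over arcs. Each edge contributes through both of its orientations.\<close>

definition arc_transform ::
  "'a pair_pre_digraph \<Rightarrow> ('a \<Rightarrow> nat) \<Rightarrow> nat \<Rightarrow> nat \<Rightarrow> complex" where
  "arc_transform G \<sigma> m k = (\<Sum>(u, v)\<in>parcs G.
     fourier_char (graph_order G) (m * \<sigma> u) * fourier_char (graph_order G) (k * \<sigma> v)) /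
     of_nat (graph_order G)"

lemma fourier_matrix_index:
  assumes "m < N" "x < N"
  shows "fourier_matrix N $$ (m, x) = fourier_char N (m * x) / complex_of_real (sqrt (real N))"
  using assms by (simp add: fourier_matrix_def fourier_char_def mult.assoc)

text \<open>Expand the matrix product and substitute \<open>x = \<sigma> u\<close>,
  \<open>y = \<sigma> v\<close>; the inverse labelings cancel and only adjacent pairs
  survive.\<close>

lemma fourier_adjacency_matrix_index:
  assumes "pair_graph G" and bij: "bij_betw \<sigma> (pverts G) {..<graph_order G}"
    and m: "m < graph_order G" and k: "k < graph_order G"
  shows "(fourier_matrix (graph_order G) * adjacency_matrix G \<sigma> *
           fourier_matrix (graph_order G)) $$ (m, k) = arc_transform G \<sigma> m k"
proof -
  interpret pair_graph G by fact
  define N where "N = graph_order G"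
  define V where "V = pverts G"
  define A where "A x y = (if (inv_into V \<sigma> x, inv_into V \<sigma> y) \<in> parcs G then 1 else 0 :: complex)"
    for x y
  have bij': "bij_betw \<sigma> V {..<N}" and m': "m < N" and k': "k < N"
    using bij m k by (simp_all add: N_def V_def)
  have inv: "inv_into V \<sigma> (\<sigma> u) = u" if "u \<in> V" for u
    using that bij' by (simp add: bij_betw_def)
  have adj: "adjacency_matrix G \<sigma> = mat N N (\<lambda>(x, y). A x y)"
    by (simp add: adjacency_matrix_def N_def V_def A_def)
  \<comment> \<open>The normalizations of the two Fourier matrices combine to the factor
    \<open>1 / N\<close>.\<close>
  have sqrt_sqrt: "complex_of_real (sqrt (real N)) * complex_of_real (sqrt (real N)) = of_nat N"
    by (metis of_real_mult of_real_of_nat_eq real_sqrt_mult_self abs_of_nat)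
  have fin: "finite V"
    by (simp add: V_def pair_finite_verts)
  have sub: "parcs G \<subseteq> V \<times> V"
    by (auto simp: V_def dest: in_arcsD1 in_arcsD2)
  have dim: "dim_row (fourier_matrix N) = N" "dim_col (fourier_matrix N) = N"
    by (simp_all add: fourier_matrix_def)
  have "(fourier_matrix N * adjacency_matrix G \<sigma> * fourier_matrix N) $$ (m, k) =
          (\<Sum>y<N. (\<Sum>x<N. fourier_matrix N $$ (m, x) * A x y) * fourier_matrix N $$ (y, k))"
    using m' k' by (simp add: adj dim scalar_prod_def lessThan_atLeast0)
  also have "\<dots> = (\<Sum>y<N. \<Sum>x<N. A x y * fourier_char N (m * x) * fourier_char N (k * y) / of_nat N)"
    using m' k'
    by (simp add: fourier_matrix_index sum_distrib_left sum_distrib_right sqrt_sqrt mult_ac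
        flip: sum_divide_distrib)
  also have "\<dots> = (\<Sum>v\<in>V. \<Sum>u\<in>V. A (\<sigma> u) (\<sigma> v) * fourier_char N (m * \<sigma> u) *
                     fourier_char N (k * \<sigma> v) / of_nat N)"
    by (simp add: sum.reindex_bij_betw [OF bij', symmetric])
  also have "\<dots> = (\<Sum>u\<in>V. \<Sum>v\<in>V. A (\<sigma> u) (\<sigma> v) * fourier_char N (m * \<sigma> u) *
                     fourier_char N (k * \<sigma> v) / of_nat N)"
    by (rule sum.swap)
  also have "\<dots> = (\<Sum>(u, v)\<in>V \<times> V. if (u, v) \<in> parcs G
                     then fourier_char N (m * \<sigma> u) * fourier_char N (k * \<sigma> v) / of_nat N else 0)"
    unfolding sum.cartesian_product by (rule sum.cong) (auto simp: A_def inv)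
  also have "\<dots> = (\<Sum>(u, v)\<in>parcs G. fourier_char N (m * \<sigma> u) * fourier_char N (k * \<sigma> v) / of_nat N)"
    using fin sub by (intro sum.mono_neutral_cong_right) auto
  also have "\<dots> = arc_transform G \<sigma> m k"
    by (simp add: arc_transform_def N_def sum_divide_distrib case_prod_beta)
  finally show ?thesis
    by (simp add: N_def)
qed

lemma fourier_ratio_adjacency_matrix:
  assumes "pair_graph G" "bij_betw \<sigma> (pverts G) {..<graph_order G}"
  shows "fourier_ratio (adjacency_matrix G \<sigma>) =
    (\<Sum>i<graph_order G. \<Sum>j<graph_order G. cmod (arc_transform G \<sigma> i j)) /
    sqrt (\<Sum>i<graph_order G. \<Sum>j<graph_order G. (cmod (arc_transform G \<sigma> i j))\<^sup>2)"
proof -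
  have "dim_row (adjacency_matrix G \<sigma>) = graph_order G"
    by (simp add: adjacency_matrix_def)
  moreover have "dim_row (fourier_matrix n) = n" "dim_col (fourier_matrix n) = n" for n
    by (simp_all add: fourier_matrix_def)
  ultimately show ?thesis
    using assms
    \<comment> \<open>Without the deletion, matrix product entries would unfold into scalar products
      before the entry formula could apply.\<close>
    by (simp add: fourier_ratio_def entrywise_l1_norm_def frobenius_norm_def Let_def
        fourier_adjacency_matrix_index del: index_mult_mat(1))
qed

section \<open>Chinese remainder bijections for frequencies and labels\<close>

lemma bij_betw_mod_coprime:
  assumes "coprime M N" "M > 0" "N > (0::nat)"
  shows "bij_betw (\<lambda>m. (m mod M, m mod N)) {..<M * N} ({..<M} \<times> {..<N})"
proof -
  have "inj_on (\<lambda>m. (m mod M, m mod N)) {..<M * N}"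
  proof (rule inj_onI)
    fix x y assume "x \<in> {..<M * N}" "y \<in> {..<M * N}" "(x mod M, x mod N) = (y mod M, y mod N)"
    then show "x = y"
      using coprime_cong_mult_nat [OF _ _ assms(1), of x y] by (simp add: cong_def)
  qed
  moreover have "(\<lambda>m. (m mod M, m mod N)) ` {..<M * N} \<subseteq> {..<M} \<times> {..<N}"
    using assms by auto
  ultimately show ?thesis
    unfolding bij_betw_def by (intro conjI card_subset_eq) (simp_all add: card_image)
qed

text \<open>Modulo \<open>M\<close> the label is \<open>N * a\<close> with \<open>N\<close>
  invertible, and symmetrically modulo \<open>N\<close>, so it determines both \<open>a\<close> and
  \<open>b\<close>. Equal cardinalities turn injectivity into bijectivity.\<close>

lemma bij_betw_crt_label:
  assumes "coprime M N" "M > 0" "N > (0::nat)"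
  shows "bij_betw (\<lambda>(a, b). (N * a + M * b) mod (M * N)) ({..<M} \<times> {..<N}) {..<M * N}"
proof -
  let ?f = "\<lambda>(a, b). (N * a + M * b) mod (M * N)"
  have "inj_on ?f ({..<M} \<times> {..<N})"
  proof (rule inj_onI, clarify)
    fix a b c d
    assume lt: "a < M" "b < N" "c < M" "d < N"
      and "(N * a + M * b) mod (M * N) = (N * c + M * d) mod (M * N)"
    then have eq: "[N * a + M * b = N * c + M * d] (mod M * N)"
      by (simp add: cong_def)
    have "[N * a = N * c] (mod M)"
      using cong_modulus_mult_nat [OF eq] by (simp add: cong_def)
    moreover have "[M * b = M * d] (mod N)"
      using cong_modulus_mult_nat [OF eq [unfolded mult.commute [of M N]]]
      by (simp add: cong_def)
    ultimately have "[a = c] (mod M)" "[b = d] (mod N)"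
      using assms(1) by (simp_all add: cong_mult_lcancel_nat coprime_commute)
    with lt show "a = c \<and> b = d"
      by (simp add: cong_def)
  qed
  moreover have "?f ` ({..<M} \<times> {..<N}) \<subseteq> {..<M * N}"
    using assms by auto
  ultimately show ?thesis
    unfolding bij_betw_def by (intro conjI card_subset_eq) (simp_all add: card_image)
qed

lemma sum_mod_coprime:
  fixes f :: "nat \<Rightarrow> nat \<Rightarrow> 'c::comm_monoid_add"
  assumes "coprime M N" "M > 0" "N > 0"
  shows "(\<Sum>m<M * N. f (m mod M) (m mod N)) = (\<Sum>a<M. \<Sum>b<N. f a b)"
  using sum.reindex_bij_betw [OF bij_betw_mod_coprime [OF assms], of "\<lambda>(a, b). f a b"]
  by (simp add: sum.cartesian_product)

text \<open>The row and column frequencies are split separately, first the inner sum and then the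
  outer one. Both norms are sums of this shape, with \<open>f\<close> and \<open>g\<close> the
  absolute values or their squares.\<close>

lemma double_sum_mod_coprime:
  fixes f g :: "nat \<Rightarrow> nat \<Rightarrow> 'c::comm_semiring_0"
  assumes "coprime M N" "M > 0" "N > 0"
  shows "(\<Sum>i<M * N. \<Sum>j<M * N. f (i mod M) (j mod M) * g (i mod N) (j mod N)) =
           (\<Sum>i<M. \<Sum>j<M. f i j) * (\<Sum>i<N. \<Sum>j<N. g i j)"
  by (simp add: sum_mod_coprime [OF assms, of "\<lambda>c d. f _ c * g _ d"]
      sum_mod_coprime [OF assms, of "\<lambda>a b. \<Sum>c<M. \<Sum>d<N. f a c * g b d"] sum_product)

section \<open>The product labeling and multiplicativity of the Fourier ratio\<close>

definition product_labeling ::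
  "'a pair_pre_digraph \<Rightarrow> 'b pair_pre_digraph \<Rightarrow> ('a \<Rightarrow> nat) \<Rightarrow> ('b \<Rightarrow> nat) \<Rightarrow> 'a \<times> 'b \<Rightarrow> nat" where
  "product_labeling G H \<sigma> \<tau> = restrict
     (\<lambda>(g, h). (graph_order H * \<sigma> g + graph_order G * \<tau> h) mod (graph_order G * graph_order H))
     (pverts G \<times> pverts H)"

lemma graph_order_weak_product:
  "graph_order (weak_product G H) = graph_order G * graph_order H"
  by (simp add: weak_product_def card_cartesian_product)

lemma product_labeling_in_labelings:
  assumes "coprime (graph_order G) (graph_order H)" "graph_order G > 0" "graph_order H > 0"
    and "\<sigma> \<in> labelings G" "\<tau> \<in> labelings H"
  shows "product_labeling G H \<sigma> \<tau> \<in> labelings (weak_product G H)"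
proof -
  let ?f = "\<lambda>(a, b). (graph_order H * a + graph_order G * b) mod (graph_order G * graph_order H)"
  have "bij_betw (map_prod \<sigma> \<tau>) (pverts G \<times> pverts H) ({..<graph_order G} \<times> {..<graph_order H})"
    using assms(4,5) by (intro bij_betw_map_prod) (simp_all add: labelings_def)
  from bij_betw_trans [OF this bij_betw_crt_label [OF assms(1-3)]]
  have "bij_betw (product_labeling G H \<sigma> \<tau>) (pverts G \<times> pverts H) {..<graph_order G * graph_order H}"
    by (rule bij_betw_cong [THEN iffD1, rotated]) (auto simp: product_labeling_def)
  then show ?thesis
    \<comment> \<open>The order is rewritten while \<open>weak_product\<close> is still folded; the
      second call unfolds it for the vertex set.\<close>
    by (simp add: labelings_def graph_order_weak_product)
      (simp add: weak_product_def product_labeling_def)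
qed

text \<open>Arcs of the product correspond to pairs of arcs, and every summand splits into a
  \<open>G\<close> factor and an \<open>H\<close> factor, so the sum over pairs is a product of two
  sums.\<close>

lemma arc_transform_weak_product:
  assumes "pair_graph G" "pair_graph H" "graph_order G > 0" "graph_order H > 0"
  shows "arc_transform (weak_product G H) (product_labeling G H \<sigma> \<tau>) m k =
    arc_transform G \<sigma> (m mod graph_order G) (k mod graph_order G) *
    arc_transform H \<tau> (m mod graph_order H) (k mod graph_order H)"
proof -
  interpret G: pair_graph G by fact
  interpret H: pair_graph H by fact
  define M N where "M = graph_order G" and "N = graph_order H"
  define \<rho> where "\<rho> = product_labeling G H \<sigma> \<tau>"
  \<comment> \<open>The shuffle turning a pair of arcs into an arc between pairs; its inverse is the
    same interchange of middle coordinates.\<close>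
  define s where "s = (\<lambda>((g1, g2), (h1, h2)). ((g1 :: 'a, h1 :: 'b), (g2 :: 'a, h2 :: 'b)))"
  have char: "fourier_char (M * N) (l * \<rho> (g, h)) =
      fourier_char M (l mod M * \<sigma> g) * fourier_char N (l mod N * \<tau> h)"
    if "g \<in> pverts G" "h \<in> pverts H" for l g h
    using fourier_char_combine [of M N] assms(3,4) that
    by (simp add: \<rho>_def product_labeling_def M_def N_def)
  have arcs: "bij_betw s (parcs G \<times> parcs H) (parcs (weak_product G H))"
    by (rule bij_betwI [where g = "\<lambda>((g1, h1), (g2, h2)). ((g1, g2), (h1, h2))"])
      (auto simp: s_def weak_product_def)
  have "(\<Sum>(u, v)\<in>parcs (weak_product G H).
          fourier_char (M * N) (m * \<rho> u) * fourier_char (M * N) (k * \<rho> v)) =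
        (\<Sum>(e, f)\<in>parcs G \<times> parcs H.
          fourier_char (M * N) (m * \<rho> (fst e, fst f)) * fourier_char (M * N) (k * \<rho> (snd e, snd f)))"
    unfolding sum.reindex_bij_betw [OF arcs, symmetric]
    by (rule sum.cong) (auto simp: s_def)
  also have "\<dots> = (\<Sum>(e, f)\<in>parcs G \<times> parcs H.
      (fourier_char M (m mod M * \<sigma> (fst e)) * fourier_char M (k mod M * \<sigma> (snd e))) *
      (fourier_char N (m mod N * \<tau> (fst f)) * fourier_char N (k mod N * \<tau> (snd f))))"
    by (rule sum.cong) (auto simp: char G.in_arcsD1 G.in_arcsD2 H.in_arcsD1 H.in_arcsD2)
  also have "\<dots> =
      (\<Sum>e\<in>parcs G. fourier_char M (m mod M * \<sigma> (fst e)) * fourier_char M (k mod M * \<sigma> (snd e))) *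
      (\<Sum>f\<in>parcs H. fourier_char N (m mod N * \<tau> (fst f)) * fourier_char N (k mod N * \<tau> (snd f)))"
    by (simp add: sum_product sum.cartesian_product)
  finally show ?thesis
    by (simp add: arc_transform_def graph_order_weak_product M_def N_def \<rho>_def case_prod_beta)
qed

lemma fourier_ratio_weak_product:
  assumes "pair_graph G" "pair_graph H" "coprime (graph_order G) (graph_order H)"
    and "graph_order G > 0" "graph_order H > 0" "\<sigma> \<in> labelings G" "\<tau> \<in> labelings H"
  shows "fourier_ratio (adjacency_matrix (weak_product G H) (product_labeling G H \<sigma> \<tau>)) =
    fourier_ratio (adjacency_matrix G \<sigma>) * fourier_ratio (adjacency_matrix H \<tau>)"
proof -
  have bij: "bij_betw (product_labeling G H \<sigma> \<tau>) (pverts (weak_product G H))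
      {..<graph_order (weak_product G H)}"
      "bij_betw \<sigma> (pverts G) {..<graph_order G}" "bij_betw \<tau> (pverts H) {..<graph_order H}"
    using product_labeling_in_labelings [OF assms(3-7)] assms(6,7) by (simp_all add: labelings_def)
  show ?thesis
    unfolding fourier_ratio_adjacency_matrix [OF pair_graph_weak_product [OF assms(1,2)] bij(1)]
      fourier_ratio_adjacency_matrix [OF assms(1) bij(2)]
      fourier_ratio_adjacency_matrix [OF assms(2) bij(3)]
      arc_transform_weak_product [OF assms(1,2,4,5)] graph_order_weak_product
      norm_mult power_mult_distrib
      double_sum_mod_coprime [OF assms(3-5), of "\<lambda>i j. cmod (arc_transform G \<sigma> i j)"
        "\<lambda>i j. cmod (arc_transform H \<tau> i j)"]
      double_sum_mod_coprime [OF assms(3-5), of "\<lambda>i j. (cmod (arc_transform G \<sigma> i j))\<^sup>2"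
        "\<lambda>i j. (cmod (arc_transform H \<tau> i j))\<^sup>2"]
    by (simp add: real_sqrt_mult)
qed

section \<open>Passing to minimizing labelings\<close>

lemma edge_complexity_attained:
  assumes "finite (pverts G)"
  obtains \<sigma> where "\<sigma> \<in> labelings G"
    "edge_complexity G = fourier_ratio (adjacency_matrix G \<sigma>)"
proof -
  have "edge_complexity G \<in> (\<lambda>\<sigma>. fourier_ratio (adjacency_matrix G \<sigma>)) ` labelings G"
    unfolding edge_complexity_def
    using assms by (intro Min_in) (simp_all add: finite_labelings labelings_nonempty)
  then show ?thesis
    using that by blast
qed

lemma graph_order_pos:
  assumes "pair_graph G" "parcs G \<noteq> {}"
  shows "graph_order G > 0"
proof -
  interpret pair_graph G by fact
  obtain u v where "(u, v) \<in> parcs G"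
    using assms(2) by auto
  then have "u \<in> pverts G"
    by (rule in_arcsD1)
  then show ?thesis
    using pair_finite_verts by (auto simp: card_gt_0_iff)
qed

theorem proposition3p4:
  fixes G :: "'a pair_pre_digraph" and H :: "'b pair_pre_digraph"
  assumes "pair_graph G" and "pair_graph H"
    and "coprime (graph_order G) (graph_order H)"
    and "parcs G \<noteq> {}" and "parcs H \<noteq> {}"
  shows "edge_complexity (weak_product G H) \<le> edge_complexity G * edge_complexity H"
proof -
  have pos: "graph_order G > 0" "graph_order H > 0"
    using assms by (simp_all add: graph_order_pos)
  then have fin: "finite (pverts G)" "finite (pverts H)"
    by (simp_all add: card_gt_0_iff)
  obtain \<sigma> where \<sigma>: "\<sigma> \<in> labelings G" "edge_complexity G = fourier_ratio (adjacency_matrix G \<sigma>)"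
    using edge_complexity_attained [OF fin(1)] .
  obtain \<tau> where \<tau>: "\<tau> \<in> labelings H" "edge_complexity H = fourier_ratio (adjacency_matrix H \<tau>)"
    using edge_complexity_attained [OF fin(2)] .
  \<comment> \<open>The product labeling is only one candidate in the minimum for the product graph,
    hence an inequality.\<close>
  have "edge_complexity (weak_product G H) \<le>
      fourier_ratio (adjacency_matrix (weak_product G H) (product_labeling G H \<sigma> \<tau>))"
    unfolding edge_complexity_def
    using product_labeling_in_labelings [OF assms(3) pos \<sigma>(1) \<tau>(1)]
    by (intro Min_le) (simp_all add: finite_labelings)
  then show ?thesis
    using fourier_ratio_weak_product [OF assms(1-3) pos \<sigma>(1) \<tau>(1)] \<sigma>(2) \<tau>(2) by simp
qed

end
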